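(* Let $\beta,c_1,c_2$ be real numbers with $c_1\neq1$, $c_2\ne1$, such that none of the hypergeometric denominators below vanishes. Let $b_n,\,\mathsf c_n,\,d_n$ be the recurrence coefficients of the multiple Meixner polynomials of the first kind given in the context, and let $T_m$ be the corresponding tetradiagonal matrices. Put $z=\frac{c_1-c_2}{1-c_2}$ and for $n\ge0$ set $$a_{6n+1}=\frac{(\beta+2n)c_1}{1-c_1},\qquad a_{6n+4}=\frac{(\beta+2n+1)c_2}{1-c_2},$$ $$a_{6n+2}=\frac{(n)_n(\beta+2n)(c_2-c_1)}{(n+1)_n(1-c_1)(1-c_2)}\cdot\frac{{}_2F_1\left[{-n,\,\beta\atop -2n+1};z\right]}{{}_2F_1\left[{-n,\,\beta\atop -2n};z\right]},\qquad a_{6n+5}=\frac{(n+1)(\beta+2n+1)(c_1-c_2)}{(2n+1)(1-c_1)(1-c_2)}\cdot\frac{{}_2F_1\left[{-n,\,\beta\atop -2n};z\right]}{{}_2F_1\left[{-n-1,\,\beta\atop -2n-1};z\right]},$$ $$a_{6n+3}=\frac{2n+1}{1-c_1}\cdot\frac{{}_2F_1\left[{-n-1,\,\beta\atop -2n-1};z\right]}{{}_2F_1\left[{-n,\,\beta\atop -2n};z\right]},\qquad a_{6n+6}=\frac{2(n+1)}{1-c_2}\cdot\frac{{}_2F_1\left[{-n-1,\,\beta\atop -2n-2};z\right]}{{}_2F_1\left[{-n-1,\,\beta\atop -2n-1};z\right]}.$$ Then for every $m\ge1$ one has the bidiagonal factorization $T_m=L_{1,m}L_{2,m}U_m$, with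 $L_{1,m},L_{2,m},U_m$ built from these $a_n$ as in the context.
   Context: Matrices. Given sequences $(b_n)_{n\ge0},(\mathsf c_n)_{n\ge1},(d_n)_{n\ge2}$, $T_m$ is the $m\times m$ matrix (rows and columns numbered from $1$) with $(T_m)_{i,i}=b_{i-1}$, $(T_m)_{i,i+1}=1$, $(T_m)_{i+1,i}=\mathsf c_i$, $(T_m)_{i+2,i}=d_{i+1}$ and all other entries $0$. Given $(a_n)_{n\ge1}$: $L_{1,m}$ is the $m\times m$ lower bidiagonal matrix with $1$'s on the diagonal and $(L_{1,m})_{i+1,i}=a_{3i-1}$; $L_{2,m}$ is lower bidiagonal with $1$'s on the diagonal and $(L_{2,m})_{i+1,i}=a_{3i}$; $U_m$ is upper bidiagonal with diagonal entries $(U_m)_{i,i}=a_{3i-2}$ and $1$'s on the superdiagonal. (The subdiagonal recurrence coefficients $\mathsf c_n$ are not to be confused with the parameters $c_1,c_2$.) Notation. $(x)_k=x(x+1)\cdots(x+k-1)$, $(x)_0=1$ (in particular $(0)_0=1$). For a nonnegative integer $p$, ${}_2F_1\left[{-p,\,x\atop u};z\right]=\sum_{j=0}^{p}\frac{(-p)_j(x)_j}{(u)_j\,j!}z^j$ (terms $j>p$ are discarded even if $u$ is a nonpositive integer). Recurrence coefficients (multiple Meixner of the first kind), $k\ge0$: $b_{2k}=k\frac{1+c_1}{1-c_1}+k\left(\frac{c_1}{1-c_1}+\frac{c_2}{1-c_2}+1\right)+\frac{c_1}{1-c_1}\beta$; $b_{2k+1}=k\frac{1+c_2}{1-c_2}+(k+1)\left(\frac{c_1}{1-c_1}+\frac{c_2}{1-c_2}+1\right)+\frac{c_2}{1-c_2}\beta$;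 $\mathsf c_{2k}=(\beta+2k-1)\left(k\frac{c_1}{(1-c_1)^2}+k\frac{c_2}{(1-c_2)^2}\right)$; $\mathsf c_{2k+1}=(\beta+2k)\left((k+1)\frac{c_1}{(1-c_1)^2}+k\frac{c_2}{(1-c_2)^2}\right)$; $d_{2k}=\frac{k(\beta+2k-2)(\beta+2k-1)c_1(c_1-c_2)}{(1-c_1)^3(1-c_2)}$; $d_{2k+1}=\frac{k(\beta+2k-1)(\beta+2k)c_2(c_2-c_1)}{(1-c_1)(1-c_2)^3}$. *)

theory Defs
  imports Complex_Main "Jordan_Normal_Form.Matrix"
begin

(* The terminating series 2F1[-p, x; u; z], cut off at j = p by definition, so that it is
   also meaningful when u is a nonpositive integer, as long as (u)_j is nonzero for j <= p. *)
definition hyp2F1_term :: "nat \<Rightarrow> real \<Rightarrow> real \<Rightarrow> real \<Rightarrow> real" where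
  "hyp2F1_term p x u z =
     (\<Sum>j\<le>p. pochhammer (- real p) j * pochhammer x j / (pochhammer u j * fact j) * z ^ j)"

(* Matrices of type mat number rows and columns from 0, the mathematical convention numbers
   them from 1.  With i and j counted from 0, the entry (T_m)_{i+1,i} = c_i becomes
   the entry (j+1, j) with value c (j+1), and (T_m)_{i+2,i} = d_{i+1} becomes the
   entry (j+2, j) with value d (j+2); similarly a_{3i-1}, a_{3i} and a_{3i-2} become
   a (3j+2), a (3j+3) and a (3i+1). *)
definition tetra_mat ::
  "(nat \<Rightarrow> real) \<Rightarrow> (nat \<Rightarrow> real) \<Rightarrow> (nat \<Rightarrow> real) \<Rightarrow> nat \<Rightarrow> real mat" where
  "tetra_mat b c d m = mat m m (\<lambda>(i, j).
     if i = j then b i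
     else if j = i + 1 then 1
     else if i = j + 1 then c (j + 1)
     else if i = j + 2 then d (j + 2)
     else 0)"

definition L1_mat :: "(nat \<Rightarrow> real) \<Rightarrow> nat \<Rightarrow> real mat" where
  "L1_mat a m = mat m m (\<lambda>(i, j).
     if i = j then 1 else if i = j + 1 then a (3 * j + 2) else 0)"

definition L2_mat :: "(nat \<Rightarrow> real) \<Rightarrow> nat \<Rightarrow> real mat" where
  "L2_mat a m = mat m m (\<lambda>(i, j).
     if i = j then 1 else if i = j + 1 then a (3 * j + 3) else 0)"

definition U_mat :: "(nat \<Rightarrow> real) \<Rightarrow> nat \<Rightarrow> real mat" where
  "U_mat a m = mat m m (\<lambda>(i, j).
     if i = j then a (3 * i + 1) else if j = i + 1 then 1 else 0)"

(* Recurrence coefficients of the multiple Meixner polynomials of the first kind.  Only the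
   values of meixner_c at n >= 1 and of meixner_d at n >= 2 enter the matrices. *)
definition meixner_b :: "real \<Rightarrow> real \<Rightarrow> real \<Rightarrow> nat \<Rightarrow> real" where
  "meixner_b \<beta> c1 c2 n = (let k = real (n div 2) in
     if even n
     then k * ((1 + c1) / (1 - c1)) + k * (c1 / (1 - c1) + c2 / (1 - c2) + 1)
            + c1 / (1 - c1) * \<beta>
     else k * ((1 + c2) / (1 - c2)) + (k + 1) * (c1 / (1 - c1) + c2 / (1 - c2) + 1)
            + c2 / (1 - c2) * \<beta>)"

definition meixner_c :: "real \<Rightarrow> real \<Rightarrow> real \<Rightarrow> nat \<Rightarrow> real" where
  "meixner_c \<beta> c1 c2 n = (let k = real (n div 2) in
     if even n
     then (\<beta> + 2 * k - 1) * (k * (c1 / (1 - c1)\<^sup>2) + k * (c2 / (1 - c2)\<^sup>2))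
     else (\<beta> + 2 * k) * ((k + 1) * (c1 / (1 - c1)\<^sup>2) + k * (c2 / (1 - c2)\<^sup>2)))"

definition meixner_d :: "real \<Rightarrow> real \<Rightarrow> real \<Rightarrow> nat \<Rightarrow> real" where
  "meixner_d \<beta> c1 c2 n = (let k = real (n div 2) in
     if even n
     then k * (\<beta> + 2 * k - 2) * (\<beta> + 2 * k - 1) * c1 * (c1 - c2)
            / ((1 - c1) ^ 3 * (1 - c2))
     else k * (\<beta> + 2 * k - 1) * (\<beta> + 2 * k) * c2 * (c2 - c1)
            / ((1 - c1) * (1 - c2) ^ 3))"

end

(* Comparing entries, T = L1 L2 U is a list of scalar equations in the a_n.  Write A_n and B_n for
   the 2F1 with parameters (-n, beta; -2n) and (-n-1, beta; -2n-1).  The numerator of a_{6n+2} is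
   B_{n-1} (for n >= 1) and that of a_{6n+6} is A_{n+1}, so in the equations for d_n and in the products
   a_{3j+2} a_{3j} the series cancel, and everything reduces to the two values
     a_{6n+2} + a_{6n+3} = (n+1)/(1-c1) + n/(1-c2),
     a_{6n+5} + a_{6n+6} = (n+1)/(1-c1) + (n+1)/(1-c2).
   These are three-term contiguous relations for B_{n-1}, A_n, B_n and for A_n, B_n, A_{n+1},
   verified on the coefficients of z^j. *)

theory Submission
  imports Defs
begin

section \<open>Products of bidiagonal matrices\<close>

text \<open>Row \<open>i\<close> of the left factor has at most two nonzero entries, so the product
  sum collapses; the \<open>case\<close> covers the first row, which has no predecessor.\<close>

lemma lower_bidiagonal_mult_index:
  fixes M :: "'a :: semiring_1 mat"
  assumes M: "M \<in> carrier_mat m l" and i: "i < m" and j: "j < l"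
  shows "(mat m m (\<lambda>(i, j). if i = j then 1 else if i = j + 1 then f j else 0) * M) $$ (i, j)
           = M $$ (i, j) + (case i of 0 \<Rightarrow> 0 | Suc k \<Rightarrow> f k * M $$ (k, j))"
    (is "(?L * M) $$ _ = _")
proof -
  have "(?L * M) $$ (i, j)
      = (\<Sum>k<m. (if i = k then 1 else if i = k + 1 then f k else 0) * M $$ (k, j))"
    using assms by (auto simp: scalar_prod_def lessThan_atLeast0 intro!: sum.cong)
  also have "\<dots> = (\<Sum>k<m. (if k = i then M $$ (i, j) else 0)
      + (if i = k + 1 then f k * M $$ (k, j) else 0))"
    by (rule sum.cong) auto
  also have "\<dots> = M $$ (i, j) + (\<Sum>k<m. if i = k + 1 then f k * M $$ (k, j) else 0)"
    using i by (simp add: sum.distrib)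
  also have "(\<Sum>k<m. if i = k + 1 then f k * M $$ (k, j) else 0)
      = (case i of 0 \<Rightarrow> 0 | Suc k \<Rightarrow> f k * M $$ (k, j))"
    using i by (cases i) auto
  finally show ?thesis .
qed

text \<open>L1 L2 has \<open>a (3 * j + 2) + a (3 * j + 3)\<close> at \<open>(j + 1, j)\<close> and
  \<open>a (3 * j + 5) * a (3 * j + 3)\<close> at \<open>(j + 2, j)\<close>. Multiplying by U gives
  one equation per diagonal, which on the superdiagonal reads 1 = 1. In the first column some terms
  drop out, hence \<open>b0\<close> and \<open>c0\<close>.\<close>

lemma tetra_mat_eq_bidiagonal_product:
  assumes b0: "b 0 = a 1"
    and b: "\<And>n. b (Suc n) = a (3 * n + 4) + a (3 * n + 2) + a (3 * n + 3)"
    and c0: "c 1 = (a 2 + a 3) * a 1"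
    and c: "\<And>n. c (n + 2) = (a (3 * n + 5) + a (3 * n + 6)) * a (3 * n + 4)
                               + a (3 * n + 5) * a (3 * n + 3)"
    and d: "\<And>n. d (n + 2) = a (3 * n + 5) * a (3 * n + 3) * a (3 * n + 1)"
  shows "tetra_mat b c d m = L1_mat a m * L2_mat a m * U_mat a m"
proof -
  have L1: "L1_mat a m \<in> carrier_mat m m" and L2: "L2_mat a m \<in> carrier_mat m m"
    and U: "U_mat a m \<in> carrier_mat m m"
    by (auto simp: L1_mat_def L2_mat_def U_mat_def)
  define V where "V = L2_mat a m * U_mat a m"
  have V: "V \<in> carrier_mat m m"
    using L2 U by (simp add: V_def)
  have U_index: "U_mat a m $$ (i, j)
      = (if i = j then a (3 * i + 1) else if j = i + 1 then 1 else 0)"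
    and V_index: "V $$ (i, j) = U_mat a m $$ (i, j)
      + (case i of 0 \<Rightarrow> 0 | Suc k \<Rightarrow> a (3 * k + 3) * U_mat a m $$ (k, j))"
    and L1V_index: "(L1_mat a m * V) $$ (i, j) = V $$ (i, j)
      + (case i of 0 \<Rightarrow> 0 | Suc k \<Rightarrow> a (3 * k + 2) * V $$ (k, j))"
    and T_index: "tetra_mat b c d m $$ (i, j) =
      (if i = j then b i else if j = i + 1 then 1 else if i = j + 1 then c (j + 1)
       else if i = j + 2 then d (j + 2) else 0)"
    if "i < m" "j < m" for i j
    using that lower_bidiagonal_mult_index[OF U] lower_bidiagonal_mult_index[OF V]
    unfolding V_def L1_mat_def L2_mat_def by (simp_all add: U_mat_def tetra_mat_def)
  have "tetra_mat b c d m = L1_mat a m * V"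
  proof (rule eq_matI)
    fix i j
    assume "i < dim_row (L1_mat a m * V)" and "j < dim_col (L1_mat a m * V)"
    then have i: "i < m" and j: "j < m"
      using L1 V by auto
    \<comment> \<open>Row \<open>i\<close> of the product draws on rows \<open>i\<close>,
      \<open>i - 1\<close> and \<open>i - 2\<close> of U, so the first two rows are separate
      cases.\<close>
    consider "i = 0" | "i = 1" | n where "i = Suc (Suc n)"
      by (metis One_nat_def not0_implies_Suc)
    then show "tetra_mat b c d m $$ (i, j) = (L1_mat a m * V) $$ (i, j)"
    proof cases
      case 1
      then show ?thesis
        using i j b0 by (simp add: T_index L1V_index V_index U_index del: index_mult_mat)
    next
      case 2
      then show ?thesis
        using i j b[of 0] c0
        by (auto simp: T_index L1V_index V_index U_index numeral_eq_Suc algebra_simps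
            simp del: index_mult_mat)
    next
      case (3 n)
      then show ?thesis
        using i j b[of "Suc n"] c[of n] d[of n]
        by (auto simp: T_index L1V_index V_index U_index numeral_eq_Suc algebra_simps
            simp del: index_mult_mat)
    qed
  qed (use L1 V in \<open>auto simp: tetra_mat_def\<close>)
  then show ?thesis
    using L1 L2 U by (simp add: V_def)
qed

section \<open>Contiguous relations\<close>

text \<open>Coefficient of z^j in 2F1 with parameters -p, x; -q. Natural \<open>p\<close> and
  \<open>q\<close> turn parameter shifts into recurrences.\<close>

definition hyp_coeff :: "real \<Rightarrow> nat \<Rightarrow> nat \<Rightarrow> nat \<Rightarrow> real" where
  "hyp_coeff x p q j = pochhammer (- real p) j * pochhammer x j / (pochhammer (- real q) j * fact j)"

text \<open>Since (-p)_j = 0 for j > p, zero terms can be appended, which puts series of different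
  lengths over one summation range.\<close>

lemma hyp2F1_term_eq_sum:
  assumes "p \<le> N"
  shows "hyp2F1_term p x (- real q) z = (\<Sum>j\<le>N. hyp_coeff x p q j * z ^ j)"
  unfolding hyp2F1_term_def hyp_coeff_def
  using assms by (intro sum.mono_neutral_left) (auto simp: pochhammer_of_nat_eq_0_iff)

lemma hyp_coeff_0 [simp]: "hyp_coeff x p q 0 = 1"
  by (simp add: hyp_coeff_def)

text \<open>Split off the first factor of (-p-1)_{j+1} and (-q-1)_{j+1} and the last factor of
  (x)_{j+1}. When (-q)_j = 0, both sides are 0 by the convention for division.\<close>

lemma hyp_coeff_Suc_Suc:
  "(real j + 1) * (real q + 1) * hyp_coeff x (Suc p) (Suc q) (Suc j)
     = (x + real j) * (real p + 1) * hyp_coeff x p q j"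
proof -
  have num: "pochhammer (- real (Suc p)) (Suc j) = - (real p + 1) * pochhammer (- real p) j"
    and den: "pochhammer (- real (Suc q)) (Suc j) = - (real q + 1) * pochhammer (- real q) j"
    by (simp_all add: pochhammer_rec)
  have "pochhammer x (Suc j) = (x + real j) * pochhammer x j"
    "fact (Suc j) = (real j + 1) * fact j"
    by (simp_all add: pochhammer_Suc mult.commute)
  moreover have "real q + 1 \<noteq> 0" "real j + 1 \<noteq> 0"
    by (metis of_nat_Suc of_nat_neq_0 add.commute)+
  moreover have "J * Q * ((- P * a) * (X * b) / ((- Q * c) * (J * f))) = X * P * (a * b / (c * f))"
    if "Q \<noteq> 0" "J \<noteq> 0" for J Q P X a b c f :: real
    using that by (simp add: divide_simps)
  ultimately show ?thesis
    unfolding hyp_coeff_def num den by metis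
qed

text \<open>Compare the splittings of (-p-1)_{j+1} at its first and at its last factor. The factor p
  + 1 - j is not divided out because it vanishes at j = p + 1.\<close>

lemma hyp_coeff_Suc_numerator:
  "(real p + 1 - real j) * hyp_coeff x (Suc p) q j = (real p + 1) * hyp_coeff x p q j"
proof -
  have "(real p + 1 - real j) * pochhammer (- real (Suc p)) j
      = (real p + 1) * pochhammer (- real p) j"
    using pochhammer_rec[of "- real (Suc p)" j] pochhammer_Suc[of "- real (Suc p)" j]
    by (simp add: algebra_simps)
  then show ?thesis
    unfolding hyp_coeff_def
    by (metis (no_types, lifting) mult.assoc times_divide_eq_right)
qed

text \<open>Coefficients with \<open>j > q\<close> are junk values of the form \<open>_ / 0\<close>; for \<open>p \<le> q\<close> they are
  harmless, since their numerator vanishes as well.\<close>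

lemma hyp_coeff_Suc_denominator:
  assumes "p \<le> q"
  shows "(real q + 1) * hyp_coeff x p (Suc q) j = (real q + 1 - real j) * hyp_coeff x p q j"
proof (cases "j \<le> p")
  case True
  have eq: "(real q + 1 - real j) * pochhammer (- real (Suc q)) j
      = (real q + 1) * pochhammer (- real q) j"
    using pochhammer_rec[of "- real (Suc q)" j] pochhammer_Suc[of "- real (Suc q)" j]
    by (simp add: algebra_simps)
  have "pochhammer (- real q) j \<noteq> 0" "pochhammer (- real (Suc q)) j \<noteq> 0"
    using True assms by (simp_all add: pochhammer_of_nat_eq_0_iff del: of_nat_Suc)
  then show ?thesis
    using arg_cong[OF eq, of "\<lambda>t. t * (pochhammer (- real p) j * pochhammer x j)"]
    unfolding hyp_coeff_def by (auto simp: divide_simps mult_ac simp del: of_nat_Suc)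
next
  case False
  then have "hyp_coeff x p u j = 0" for u
    by (simp add: hyp_coeff_def pochhammer_of_nat_eq_0_iff)
  then show ?thesis by simp
qed

text \<open>Comparison of coefficients: \<open>f\<close> collects the part of a relation free of
  \<open>z\<close>, \<open>g\<close> the part multiplied by \<open>z\<close>, so z^(j+1) has
  coefficient \<open>f (Suc j) + g j\<close>.\<close>

lemma power_sum_shift_eq_0:
  fixes z :: "'a :: comm_ring_1"
  assumes "f 0 = 0" and "\<And>j. j \<le> N \<Longrightarrow> f (Suc j) + g j = 0"
  shows "(\<Sum>j\<le>Suc N. f j * z ^ j) + z * (\<Sum>j\<le>N. g j * z ^ j) = 0"
proof -
  have "(\<Sum>j\<le>Suc N. f j * z ^ j) + z * (\<Sum>j\<le>N. g j * z ^ j)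
      = (\<Sum>j\<le>N. (f (Suc j) + g j) * z ^ Suc j)"
    by (simp add: sum.atMost_Suc_shift assms(1) sum_distrib_left sum.distrib[symmetric]
        algebra_simps del: sum.atMost_Suc)
  then show ?thesis
    using assms(2) by simp
qed

text \<open>The relation between A_n, B_n and A_{n+1}, needed for a_{6n+5} + a_{6n+6}.\<close>

lemma hyp_contiguous_even:
  fixes z x :: real and n :: nat
  defines "F \<equiv> \<lambda>p q :: nat. hyp2F1_term p x (- real q) z"
  shows "(x + 2 * real n + 1) * z * F n (2 * n)
      + 2 * (2 * real n + 1) * (1 - z) * F (Suc n) (2 * n + 2)
    = (2 * real n + 1) * (2 - z) * F (Suc n) (2 * n + 1)"
proof -
  define h where "h = hyp_coeff x"
  \<comment> \<open>Left side minus right side, sorted into the part without \<open>z\<close>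
    (\<open>f\<close>) and the cofactor of \<open>z\<close> (\<open>g\<close>).\<close>
  define f where
    "f j = 2 * (2 * real n + 1) * (h (Suc n) (2 * n + 2) j - h (Suc n) (2 * n + 1) j)" for j
  define g where "g j = (x + 2 * real n + 1) * h n (2 * n) j
      + (2 * real n + 1) * (h (Suc n) (2 * n + 1) j - 2 * h (Suc n) (2 * n + 2) j)" for j
  have F: "F n (2 * n) = (\<Sum>j\<le>Suc n. h n (2 * n) j * z ^ j)"
    "F (Suc n) q = (\<Sum>j\<le>Suc n. h (Suc n) q j * z ^ j)"
    "F (Suc n) q = (\<Sum>j\<le>Suc (Suc n). h (Suc n) q j * z ^ j)" for q
    unfolding F_def h_def by (rule hyp2F1_term_eq_sum; simp)+
  have step: "f (Suc j) + g j = 0" for j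
  proof -
    define P where "P = h n (2 * n) j"
    define H where "H = h n (2 * n + 1) j"
    define Y where "Y = h (Suc n) (2 * n + 1) j"
    define Y' where "Y' = h (Suc n) (2 * n + 2) j"
    have PH: "(2 * real n + 1) * H = (2 * real n + 1 - real j) * P"
      using hyp_coeff_Suc_denominator[of n "2 * n" x j] by (simp add: P_def H_def h_def)
    have "(real n + 1 - real j) * Y = (real n + 1) * H"
      using hyp_coeff_Suc_numerator[of n j x "2 * n + 1"] by (simp add: Y_def H_def h_def)
    moreover have "(2 * real n + 2) * Y' = (2 * real n + 2 - real j) * Y"
      using hyp_coeff_Suc_denominator[of "Suc n" "2 * n + 1" x j]
      by (simp add: Y_def Y'_def h_def algebra_simps)
    \<comment> \<open>In terms of \<open>Y\<close> the coefficient is (n+1) - (2n+2-j) + (n+1-j) =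
      0. As \<open>g\<close> contains \<open>Y\<close> and \<open>Y'\<close> only through
      \<open>Y - 2 * Y'\<close>, no division by n + 1 - j, which is 0 at j = n + 1, is
      required.\<close>
    ultimately have "(real n + 1) * (Y - 2 * Y' + H) = 0"
      by argo
    then have YH: "Y - 2 * Y' = - H"
      by (simp add: add_eq_0_iff2 del: of_nat_Suc)
    have Z': "(real j + 1) * (2 * h (Suc n) (2 * n + 2) (Suc j)) = (x + real j) * H"
    proof -
      have "(real n + 1) * ((real j + 1) * (2 * h (Suc n) (2 * n + 2) (Suc j)))
          = (real n + 1) * ((x + real j) * H)"
        using hyp_coeff_Suc_Suc[of j "2 * n + 1" x n] by (simp add: H_def h_def algebra_simps)
      then show ?thesis
        by (simp add: add_eq_0_iff2)
    qed
    have Z: "(real j + 1) * ((2 * real n + 1) * h (Suc n) (2 * n + 1) (Suc j))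
        = (x + real j) * ((real n + 1) * P)"
      using hyp_coeff_Suc_Suc[of j "2 * n" x n] by (simp add: P_def h_def mult_ac)
    have "(real j + 1) * (f (Suc j) + g j)
      = (2 * real n + 1) * ((x + real j) * H) - 2 * ((x + real j) * ((real n + 1) * P))
        + (real j + 1) * ((x + 2 * real n + 1) * P - (2 * real n + 1) * H)"
      unfolding f_def g_def Z[symmetric] Z'[symmetric] P_def[symmetric]
        Y_def[symmetric] Y'_def[symmetric] YH by (simp add: algebra_simps)
    \<comment> \<open>Collecting \<open>H\<close> and \<open>P\<close> leaves x - 1 times the
      difference of the two sides of \<open>PH\<close>.\<close>
    also have "\<dots> = (x - 1) * ((2 * real n + 1) * H - (2 * real n + 1 - real j) * P)"
      by (simp add: algebra_simps)
    also have "\<dots> = 0"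
      by (simp add: PH)
    finally show ?thesis
      by (simp add: add_eq_0_iff2)
  qed
  have "(\<Sum>j\<le>Suc (Suc n). f j * z ^ j) + z * (\<Sum>j\<le>Suc n. g j * z ^ j) = 0"
    using step by (intro power_sum_shift_eq_0) (auto simp: f_def h_def)
  moreover have "(\<Sum>j\<le>Suc (Suc n). f j * z ^ j)
      = 2 * (2 * real n + 1) * (F (Suc n) (2 * n + 2) - F (Suc n) (2 * n + 1))"
    unfolding F(3) f_def
    by (simp only: left_diff_distrib right_diff_distrib mult.assoc sum_subtractf sum_distrib_left)
  moreover have "(\<Sum>j\<le>Suc n. g j * z ^ j) = (x + 2 * real n + 1) * F n (2 * n)
      + (2 * real n + 1) * (F (Suc n) (2 * n + 1) - 2 * F (Suc n) (2 * n + 2))"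
    unfolding F(1,2) g_def sum_distrib_left sum_subtractf[symmetric] sum.distrib[symmetric]
    by (rule sum.cong) (auto simp: algebra_simps)
  ultimately have "2 * (2 * real n + 1) * (F (Suc n) (2 * n + 2) - F (Suc n) (2 * n + 1))
      + z * ((x + 2 * real n + 1) * F n (2 * n)
        + (2 * real n + 1) * (F (Suc n) (2 * n + 1) - 2 * F (Suc n) (2 * n + 2))) = 0"
    by (simp only:)
  then show ?thesis
    by (simp add: algebra_simps)
qed

text \<open>The relation between B_{n-1}, A_n and B_n, needed for a_{6n+2} + a_{6n+3} with n >= 1;
  it is stated with n + 1 in place of n to avoid subtraction.\<close>

lemma hyp_contiguous_odd:
  fixes z x :: real and n :: nat
  defines "F \<equiv> \<lambda>p q :: nat. hyp2F1_term p x (- real q) z"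
  shows "2 * (2 * real n + 3) * F (n + 2) (2 * n + 3)
      - (x + 2 * real n + 2) * z * F (Suc n) (2 * n + 1)
    = 2 * (real n + 2 + (real n + 1) * (1 - z)) * F (Suc n) (2 * n + 2)"
proof -
  define h where "h = hyp_coeff x"
  define f where
    "f j = 2 * (2 * real n + 3) * (h (n + 2) (2 * n + 3) j - h (Suc n) (2 * n + 2) j)" for j
  define g where "g j = 2 * (real n + 1) * h (Suc n) (2 * n + 2) j
      - (x + 2 * real n + 2) * h (Suc n) (2 * n + 1) j" for j
  have F: "F (Suc n) q = (\<Sum>j\<le>Suc n. h (Suc n) q j * z ^ j)"
    "F (Suc n) q = (\<Sum>j\<le>Suc (Suc n). h (Suc n) q j * z ^ j)"
    "F (n + 2) q = (\<Sum>j\<le>Suc (Suc n). h (n + 2) q j * z ^ j)" for q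
    unfolding F_def h_def by (rule hyp2F1_term_eq_sum; simp)+
  have step: "f (Suc j) + g j = 0" for j
  proof -
    define A where "A = h (Suc n) (2 * n + 2) j"
    define V where "V = h (Suc n) (2 * n + 1) j"
    define W where "W = h n (2 * n + 1) j"
    have AV: "(2 * real n + 2) * A = (2 * real n + 2 - real j) * V"
      using hyp_coeff_Suc_denominator[of "Suc n" "2 * n + 1" x j]
      by (simp add: A_def V_def h_def algebra_simps)
    have VW: "(real n + 1 - real j) * V = (real n + 1) * W"
      using hyp_coeff_Suc_numerator[of n j x "2 * n + 1"] by (simp add: V_def W_def h_def)
    have A': "(real j + 1) * (2 * h (Suc n) (2 * n + 2) (Suc j)) = (x + real j) * W"
    proof -
      have "(real n + 1) * ((real j + 1) * (2 * h (Suc n) (2 * n + 2) (Suc j)))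
          = (real n + 1) * ((x + real j) * W)"
        using hyp_coeff_Suc_Suc[of j "2 * n + 1" x n] by (simp add: W_def h_def algebra_simps)
      then show ?thesis
        by (simp add: add_eq_0_iff2)
    qed
    have B': "(real j + 1) * ((2 * real n + 3) * h (n + 2) (2 * n + 3) (Suc j))
        = (x + real j) * ((real n + 2) * A)"
      using hyp_coeff_Suc_Suc[of j "2 * n + 2" x "Suc n"]
      by (simp add: A_def h_def numeral_eq_Suc mult_ac add.commute)
    have fg: "(real j + 1) * (f (Suc j) + g j)
      = 2 * ((x + real j) * ((real n + 2) * A)) - (2 * real n + 3) * ((x + real j) * W)
        + (real j + 1) * (2 * (real n + 1) * A - (x + 2 * real n + 2) * V)"
      unfolding f_def g_def A'[symmetric] B'[symmetric] A_def[symmetric] V_def[symmetric]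
      by (simp add: algebra_simps)
    \<comment> \<open>The multipliers of \<open>AV\<close> and \<open>VW\<close> are forced by the
      coefficients of \<open>A\<close> and \<open>W\<close>; the terms in \<open>V\<close> then
      agree. The factor n + 1 keeps the multipliers polynomial.\<close>
    have "(real n + 1) * ((real j + 1) * (f (Suc j) + g j))
      = ((x + real j) * (real n + 2) + (real j + 1) * (real n + 1))
          * ((2 * real n + 2) * A - (2 * real n + 2 - real j) * V)
        + (2 * real n + 3) * (x + real j) * ((real n + 1 - real j) * V - (real n + 1) * W)"
      unfolding fg by (simp add: algebra_simps)
    also have "\<dots> = 0"
      by (simp add: AV VW)
    finally show ?thesis
      by (simp add: add_eq_0_iff2)
  qed
  have "(\<Sum>j\<le>Suc (Suc n). f j * z ^ j) + z * (\<Sum>j\<le>Suc n. g j * z ^ j) = 0"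
    using step by (intro power_sum_shift_eq_0) (auto simp: f_def h_def)
  moreover have "(\<Sum>j\<le>Suc (Suc n). f j * z ^ j)
      = 2 * (2 * real n + 3) * (F (n + 2) (2 * n + 3) - F (Suc n) (2 * n + 2))"
    unfolding F(2,3) f_def
    by (simp only: left_diff_distrib right_diff_distrib mult.assoc sum_subtractf sum_distrib_left)
  moreover have "(\<Sum>j\<le>Suc n. g j * z ^ j)
      = 2 * (real n + 1) * F (Suc n) (2 * n + 2) - (x + 2 * real n + 2) * F (Suc n) (2 * n + 1)"
    unfolding F(1) g_def
    by (simp only: left_diff_distrib right_diff_distrib mult.assoc sum_subtractf sum_distrib_left)
  ultimately have "2 * (2 * real n + 3) * (F (n + 2) (2 * n + 3) - F (Suc n) (2 * n + 2))
      + z * (2 * (real n + 1) * F (Suc n) (2 * n + 2)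
        - (x + 2 * real n + 2) * F (Suc n) (2 * n + 1)) = 0"
    by (simp only:)
  then show ?thesis
    by (simp add: algebra_simps)
qed

text \<open>Splitting (n)_{n+1} at its first or last factor gives n (n+1)_n = 2n (n)_n. At n = 0
  both symbols are 1, so a_2 has a different prefactor from the later a_{6n+2}.\<close>

lemma pochhammer_of_nat_plus_1:
  assumes "n > 0"
  shows "pochhammer (real n + 1) n = 2 * pochhammer (real n) n"
proof -
  have "real n * pochhammer (real n + 1) n = real n * (2 * pochhammer (real n) n)"
    using pochhammer_rec[of "real n" n] pochhammer_Suc[of "real n" n] by (auto simp: mult.commute)
  then show ?thesis
    using assms by simp
qed

section \<open>The recurrence coefficients\<close>

text \<open>With U = 1/(1-c1) and V = 1/(1-c2), c1/(1-c1) = U - 1 and (c1-c2)/((1-c1)(1-c2)) = U -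
  V. The coefficients become polynomials, and the final comparison is ring arithmetic.\<close>

lemma meixner_coeffs_reciprocal:
  fixes \<beta> c1 c2 :: real
  assumes c1: "c1 \<noteq> 1" and c2: "c2 \<noteq> 1"
  defines "U \<equiv> 1 / (1 - c1)" and "V \<equiv> 1 / (1 - c2)"
  shows "meixner_b \<beta> c1 c2 (2 * k) = real k * (2 * U - 1) + real k * (U + V - 1) + (U - 1) * \<beta>"
    and "meixner_b \<beta> c1 c2 (Suc (2 * k))
      = real k * (2 * V - 1) + (real k + 1) * (U + V - 1) + (V - 1) * \<beta>"
    and "meixner_c \<beta> c1 c2 (2 * k)
      = (\<beta> + 2 * real k - 1) * (real k * (U * (U - 1)) + real k * (V * (V - 1)))"
    and "meixner_c \<beta> c1 c2 (Suc (2 * k))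
      = (\<beta> + 2 * real k) * ((real k + 1) * (U * (U - 1)) + real k * (V * (V - 1)))"
    and "meixner_d \<beta> c1 c2 (2 * k)
      = real k * (\<beta> + 2 * real k - 2) * (\<beta> + 2 * real k - 1) * (U - 1) * U * (U - V)"
    and "meixner_d \<beta> c1 c2 (Suc (2 * k))
      = real k * (\<beta> + 2 * real k - 1) * (\<beta> + 2 * real k) * (V - 1) * V * (V - U)"
proof -
  have quot: "c / (1 - c) = 1 / (1 - c) - 1" "(1 + c) / (1 - c) = 2 * (1 / (1 - c)) - 1"
    "c / (1 - c)\<^sup>2 = 1 / (1 - c) * (1 / (1 - c) - 1)"
    if "c \<noteq> 1" for c :: real
    using that by (simp_all add: field_simps power2_eq_square)
  have diff: "x * c * (c - c') / ((1 - c) ^ 3 * (1 - c'))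
      = x * (1 / (1 - c) - 1) * (1 / (1 - c)) * (1 / (1 - c) - 1 / (1 - c'))"
    if "c \<noteq> 1" "c' \<noteq> 1" for x c c' :: real
  proof -
    have "1 / (1 - c) - 1 = c / (1 - c)"
      "1 / (1 - c) - 1 / (1 - c') = (c - c') / ((1 - c) * (1 - c'))"
      using that by (simp_all add: divide_simps)
    then show ?thesis
      by (simp add: power3_eq_cube mult_ac)
  qed
  show "meixner_b \<beta> c1 c2 (2 * k) = real k * (2 * U - 1) + real k * (U + V - 1) + (U - 1) * \<beta>"
    "meixner_b \<beta> c1 c2 (Suc (2 * k))
      = real k * (2 * V - 1) + (real k + 1) * (U + V - 1) + (V - 1) * \<beta>"
    by (simp_all add: meixner_b_def Let_def quot[OF c1] quot[OF c2] U_def V_def)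
  show "meixner_c \<beta> c1 c2 (2 * k)
      = (\<beta> + 2 * real k - 1) * (real k * (U * (U - 1)) + real k * (V * (V - 1)))"
    "meixner_c \<beta> c1 c2 (Suc (2 * k))
      = (\<beta> + 2 * real k) * ((real k + 1) * (U * (U - 1)) + real k * (V * (V - 1)))"
    unfolding meixner_c_def Let_def quot[OF c1] quot[OF c2] by (simp_all add: U_def V_def)
  show "meixner_d \<beta> c1 c2 (2 * k)
      = real k * (\<beta> + 2 * real k - 2) * (\<beta> + 2 * real k - 1) * (U - 1) * U * (U - V)"
    using diff[OF c1 c2] by (simp add: meixner_d_def Let_def U_def V_def)
  show "meixner_d \<beta> c1 c2 (Suc (2 * k))
      = real k * (\<beta> + 2 * real k - 1) * (\<beta> + 2 * real k) * (V - 1) * V * (V - U)"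
    using diff[OF c2 c1] by (simp add: meixner_d_def Let_def U_def V_def mult.commute[of "1 - c1"])
qed

section \<open>Factorization of the Meixner matrices\<close>

theorem proposition3p2:
  fixes \<beta> c1 c2 z :: real and a :: "nat \<Rightarrow> real" and m :: nat
  assumes c1: "c1 \<noteq> 1" and c2: "c2 \<noteq> 1"
    and z: "z = (c1 - c2) / (1 - c2)"
    and denom1: "\<And>n::nat. hyp2F1_term n \<beta> (- 2 * real n) z \<noteq> 0"
    and denom2: "\<And>n::nat. hyp2F1_term (n + 1) \<beta> (- 2 * real n - 1) z \<noteq> 0"
    and a1: "\<And>n::nat. a (6 * n + 1) = (\<beta> + 2 * real n) * c1 / (1 - c1)"
    and a4: "\<And>n::nat. a (6 * n + 4) = (\<beta> + 2 * real n + 1) * c2 / (1 - c2)"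
    and a2: "\<And>n::nat. a (6 * n + 2) =
        (pochhammer (real n) n * (\<beta> + 2 * real n) * (c2 - c1))
          / (pochhammer (real n + 1) n * (1 - c1) * (1 - c2))
        * (hyp2F1_term n \<beta> (- 2 * real n + 1) z / hyp2F1_term n \<beta> (- 2 * real n) z)"
    and a5: "\<And>n::nat. a (6 * n + 5) =
        ((real n + 1) * (\<beta> + 2 * real n + 1) * (c1 - c2))
          / ((2 * real n + 1) * (1 - c1) * (1 - c2))
        * (hyp2F1_term n \<beta> (- 2 * real n) z / hyp2F1_term (n + 1) \<beta> (- 2 * real n - 1) z)"
    and a3: "\<And>n::nat. a (6 * n + 3) =
        (2 * real n + 1) / (1 - c1)
        * (hyp2F1_term (n + 1) \<beta> (- 2 * real n - 1) z / hyp2F1_term n \<beta> (- 2 * real n) z)"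
    and a6: "\<And>n::nat. a (6 * n + 6) =
        2 * (real n + 1) / (1 - c2)
        * (hyp2F1_term (n + 1) \<beta> (- 2 * real n - 2) z
           / hyp2F1_term (n + 1) \<beta> (- 2 * real n - 1) z)"
    and m: "m \<ge> 1"
  shows "tetra_mat (meixner_b \<beta> c1 c2) (meixner_c \<beta> c1 c2) (meixner_d \<beta> c1 c2) m
           = L1_mat a m * L2_mat a m * U_mat a m"
proof -
  define u v where "u = 1 - c1" and "v = 1 - c2"
  have u: "u \<noteq> 0" and v: "v \<noteq> 0" and c1_eq: "c1 = 1 - u" and c2_eq: "c2 = 1 - v"
    using c1 c2 by (auto simp: u_def v_def)
  define U V where "U = 1 / u" and "V = 1 / v"
  \<comment> \<open>Multiplying a contiguous relation by \<open>v\<close> thus removes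
    \<open>z\<close>: v z = v - u and v (2 - z) = u + v.\<close>
  have u_eq: "u = (1 - z) * v"
    using v by (simp add: z c1_eq c2_eq field_simps)
  define A B where "A n = hyp2F1_term n \<beta> (- real (2 * n)) z"
    and "B n = hyp2F1_term (Suc n) \<beta> (- real (2 * n + 1)) z" for n
  have B_eq: "B n = hyp2F1_term (n + 1) \<beta> (- 2 * real n - 1) z"
    and B_eq': "B n = hyp2F1_term (Suc n) \<beta> (- 2 * real (Suc n) + 1) z"
    and A_Suc: "A (Suc n) = hyp2F1_term (n + 1) \<beta> (- 2 * real n - 2) z" for n
    unfolding A_def B_def
    by (rule arg_cong2[where f = "\<lambda>p u. hyp2F1_term p \<beta> u z"]; simp)+
  have A: "A n \<noteq> 0" and B: "B n \<noteq> 0" for n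
    using denom1[of n] denom2[of n] by (simp_all add: A_def B_eq)
  have a3: "a (6 * n + 3) = (2 * real n + 1) / u * (B n / A n)"
    and a5: "a (6 * n + 5) =
      (real n + 1) * (\<beta> + 2 * real n + 1) * (v - u) / ((2 * real n + 1) * u * v) * (A n / B n)"
    and a6: "a (6 * n + 6) = 2 * (real n + 1) / v * (A (Suc n) / B n)"
    and a8: "a (6 * n + 8) = (\<beta> + 2 * real n + 2) * (u - v) / (2 * u * v) * (B n / A (Suc n))"
    for n
  proof -
    show "a (6 * n + 3) = (2 * real n + 1) / u * (B n / A n)"
      unfolding a3 by (simp add: A_def B_eq u_def)
    show "a (6 * n + 5) =
      (real n + 1) * (\<beta> + 2 * real n + 1) * (v - u) / ((2 * real n + 1) * u * v) * (A n / B n)"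
      unfolding a5 by (simp add: A_def B_eq u_def v_def)
    show "a (6 * n + 6) = 2 * (real n + 1) / v * (A (Suc n) / B n)"
      unfolding a6 A_Suc B_eq v_def ..
    \<comment> \<open>Here \<open>6 * n + 8 = 6 * Suc n + 2\<close>, and at the positive index
      \<open>Suc n\<close> the Pochhammer quotient in \<open>a2\<close> is 1/2.\<close>
    define P where "P = pochhammer (real (Suc n)) (Suc n)"
    have P: "P \<noteq> 0"
      by (simp add: P_def pochhammer_eq_0_iff)
    have "a (6 * Suc n + 2) = P * (\<beta> + 2 * real (Suc n)) * (c2 - c1)
        / (2 * P * (1 - c1) * (1 - c2)) * (B n / A (Suc n))"
      unfolding a2 P_def by (simp add: pochhammer_of_nat_plus_1 A_def B_eq'
          del: of_nat_Suc mult_Suc_right)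
    then show "a (6 * n + 8)
        = (\<beta> + 2 * real n + 2) * (u - v) / (2 * u * v) * (B n / A (Suc n))"
      using P by (simp add: c1_eq c2_eq add_ac)
  qed
  have sum_even: "a (6 * n + 5) + a (6 * n + 6) = (real n + 1) * (U + V)" for n
  proof -
    define k where "k = 2 * real n + 1"
    have k: "k \<noteq> 0" and \<beta>k: "\<beta> + 2 * real n + 1 = \<beta> + k"
      unfolding k_def by linarith+
    have "(\<beta> + k) * z * A n + 2 * k * (1 - z) * A (Suc n) = k * (2 - z) * B n"
      using hyp_contiguous_even[of \<beta> n z] by (simp add: A_def B_def k_def add_ac)
    then have "v * ((\<beta> + k) * z * A n + 2 * k * (1 - z) * A (Suc n)) = v * (k * (2 - z) * B n)"
      by (rule arg_cong)
    then have rel: "(\<beta> + k) * (v - u) * A n + 2 * k * u * A (Suc n) = k * (u + v) * B n"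
      by (simp add: u_eq algebra_simps)
    \<comment> \<open>Over this common denominator the numerator is the left side of
      \<open>rel\<close>, and B_n cancels after rewriting.\<close>
    have "a (6 * n + 5) + a (6 * n + 6) = (real n + 1) / (k * u * v * B n)
        * ((\<beta> + k) * (v - u) * A n + 2 * k * u * A (Suc n))"
      unfolding a5 a6 \<beta>k k_def[symmetric] using u v k B[of n] by (simp add: field_simps)
    also have "\<dots> = (real n + 1) * (U + V)"
      unfolding rel using u v k B[of n] by (simp add: U_def V_def field_simps)
    finally show ?thesis .
  qed
  have sum_odd: "a (6 * n + 2) + a (6 * n + 3) = (real n + 1) * U + real n * V" for n
  proof (cases n)
    case 0
    \<comment> \<open>Directly, a_2 = -\<beta> z / u and a_3 = (1 + \<beta> z) / u, with sum 1 /
      u.\<close>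
    have "A 0 = 1" "B 0 = 1 + \<beta> * z"
      by (simp_all add: A_def B_def hyp2F1_term_def)
    moreover have "u - v = - (z * v)"
      by (simp add: u_eq algebra_simps)
    ultimately show ?thesis
      using 0 a2[of 0] a3[of 0] u v
      by (simp add: hyp2F1_term_def c1_eq c2_eq U_def add_divide_distrib)
  next
    case (Suc k)
    have "2 * (2 * real k + 3) * B (Suc k) - (\<beta> + 2 * real k + 2) * z * B k
        = 2 * (real k + 2 + (real k + 1) * (1 - z)) * A (Suc k)"
      using hyp_contiguous_odd[of k \<beta> z] by (simp add: A_def B_def numeral_eq_Suc add_ac)
    then have "v * (2 * (2 * real k + 3) * B (Suc k) - (\<beta> + 2 * real k + 2) * z * B k)
        = v * (2 * (real k + 2 + (real k + 1) * (1 - z)) * A (Suc k))"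
      by (rule arg_cong)
    then have rel: "2 * (2 * real k + 3) * v * B (Suc k) - (\<beta> + 2 * real k + 2) * (v - u) * B k
        = 2 * ((real k + 2) * v + (real k + 1) * u) * A (Suc k)"
      by (simp add: u_eq algebra_simps)
    have idx: "6 * n + 2 = 6 * k + 8"
      by (simp add: Suc)
    have "a (6 * n + 2) + a (6 * n + 3) = 1 / (2 * u * v * A (Suc k))
        * (2 * (2 * real k + 3) * v * B (Suc k) - (\<beta> + 2 * real k + 2) * (v - u) * B k)"
      unfolding idx a8 a3 using u v A[of "Suc k"] by (simp add: Suc field_simps)
    also have "\<dots> = (real n + 1) * U + real n * V"
      unfolding rel using u v A[of "Suc k"] by (simp add: Suc U_def V_def field_simps)
    finally show ?thesis .
  qed
  have prod_even: "a (6 * n + 5) * a (6 * n + 3)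
      = (real n + 1) * (\<beta> + 2 * real n + 1) * U * (U - V)" for n
  proof -
    have "a (6 * n + 5) * a (6 * n + 3)
        = (real n + 1) * (\<beta> + 2 * real n + 1) * ((v - u) / (u * (u * v)))"
      unfolding a5 a3 using u v A[of n] B[of n] by (simp add: divide_simps)
    also have "(v - u) / (u * (u * v)) = U * (U - V)"
      using u v by (simp add: U_def V_def field_simps)
    finally show ?thesis
      by (simp only: mult.assoc)
  qed
  have prod_odd: "a (6 * n + 8) * a (6 * n + 6)
      = (real n + 1) * (\<beta> + 2 * real n + 2) * V * (V - U)" for n
  proof -
    have "a (6 * n + 8) * a (6 * n + 6)
        = (real n + 1) * (\<beta> + 2 * real n + 2) * ((u - v) / (v * (u * v)))"
      unfolding a8 a6 using u v A[of "Suc n"] B[of n] by (simp add: field_simps)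
    also have "(u - v) / (v * (u * v)) = V * (V - U)"
      using u v by (simp add: U_def V_def field_simps)
    finally show ?thesis
      by (simp only: mult.assoc)
  qed
  have a1: "a (6 * n + 1) = (\<beta> + 2 * real n) * (U - 1)"
    and a4: "a (6 * n + 4) = (\<beta> + 2 * real n + 1) * (V - 1)" for n
    unfolding a1 a4 using u v by (simp_all add: c1_eq c2_eq U_def V_def field_simps)
  note meixner =
    meixner_coeffs_reciprocal[OF c1 c2, of \<beta>, folded u_def v_def, folded U_def V_def]
  show ?thesis
  proof (rule tetra_mat_eq_bidiagonal_product)
    show "meixner_b \<beta> c1 c2 0 = a 1"
      using a1[of 0] meixner(1)[of 0] by simp
    show "meixner_c \<beta> c1 c2 1 = (a 2 + a 3) * a 1"
      using a1[of 0] sum_odd[of 0] meixner(4)[of 0] by (simp add: numeral_2_eq_2)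
  next
    fix n :: nat
    \<comment> \<open>The formulas for \<open>a\<close> have period six in the index while the
      matrix equations advance by three, so parity decides which formulas apply.\<close>
    obtain k where "n = 2 * k \<or> n = 2 * k + 1"
      by (metis evenE oddE)
    then have "meixner_b \<beta> c1 c2 (Suc n) = a (3 * n + 4) + a (3 * n + 2) + a (3 * n + 3)
      \<and> meixner_c \<beta> c1 c2 (n + 2)
        = (a (3 * n + 5) + a (3 * n + 6)) * a (3 * n + 4) + a (3 * n + 5) * a (3 * n + 3)
      \<and> meixner_d \<beta> c1 c2 (n + 2) = a (3 * n + 5) * a (3 * n + 3) * a (3 * n + 1)"
    proof
      assume n: "n = 2 * k"
      have idx: "3 * n + i = 6 * k + i" "Suc n = Suc (2 * k)" "n + 2 = 2 * Suc k" for i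
        by (simp_all add: n)
      show ?thesis
        \<comment> \<open>Reassociation makes the two-term sum of \<open>sum_odd\<close> a subterm
          of the equation for \<open>b\<close>.\<close>
        unfolding idx add.assoc[of "a (6 * k + 4)"]
        unfolding sum_even sum_odd prod_even a1 a4 meixner
        by (simp add: algebra_simps)
    next
      assume n: "n = 2 * k + 1"
      have idx: "3 * n + 1 = 6 * k + 4" "3 * n + 2 = 6 * k + 5" "3 * n + 3 = 6 * k + 6"
        "3 * n + 4 = 6 * Suc k + 1" "3 * n + 5 = 6 * k + 8" "3 * n + 6 = 6 * Suc k + 3"
        "Suc n = 2 * Suc k" "n + 2 = Suc (2 * Suc k)"
        by (simp_all add: n)
      \<comment> \<open>For odd \<open>n\<close> the sum in the equation for \<open>c\<close>
        belongs to the next block of six, so \<open>sum_odd\<close> is taken at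
        \<open>Suc k\<close>.\<close>
      have "6 * k + 8 = 6 * Suc k + 2"
        by simp
      then have sum: "a (6 * k + 8) + a (6 * Suc k + 3) = (real (Suc k) + 1) * U + real (Suc k) * V"
        using sum_odd by metis
      show ?thesis
        unfolding idx add.assoc[of "a (6 * Suc k + 1)"]
        unfolding sum sum_even prod_odd a1 a4 meixner
        by (simp add: algebra_simps)
    qed
    then show "meixner_b \<beta> c1 c2 (Suc n) = a (3 * n + 4) + a (3 * n + 2) + a (3 * n + 3)"
      and "meixner_c \<beta> c1 c2 (n + 2)
        = (a (3 * n + 5) + a (3 * n + 6)) * a (3 * n + 4) + a (3 * n + 5) * a (3 * n + 3)"
      and "meixner_d \<beta> c1 c2 (n + 2) = a (3 * n + 5) * a (3 * n + 3) * a (3 * n + 1)"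
      by blast+
  qed
qed

end
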